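(* Let $n\ge2$ and $|q_{ij}|=1$ for $1\le i,j\le n$. Let $\underline{S}'=(S_1',\ldots,S_n')$ be the tuple of multiplication operators on $\mathcal{H}'$ (the completion of the polynomials in $q$-commuting variables), and let $\underline{S}=(S_1,\ldots,S_n)$ be the standard $q$-commuting tuple of operators on $\Gamma_q(\mathbb{C}^n)$. Then there exists a unitary $U:\mathcal{H}'\to\Gamma_q(\mathbb{C}^n)$ such that $US_i'=S_iU$ for $1\le i\le n$.
   Context: Fix complex numbers $(q_{ij})_{1\le i,j\le n}$ with $|q_{ij}|=1$, $q_{ii}=1$ and $q_{ji}=q_{ij}^{-1}=\overline{q_{ij}}$. The space $\mathcal{H}'$: let $\mathcal{P}$ be the vector space of all complex polynomials in $q$-commuting variables $z_1,\ldots,z_n$, i.e. $z_jz_i=q_{ij}z_iz_j$. It has as linear basis the monomials $\underline{z}^{\underline{k}}=z_1^{k_1}\cdots z_n^{k_n}$, $\underline{k}=(k_1,\ldots,k_n)$ an $n$-tuple of non-negative integers ($\underline z^{(0,\ldots,0)}=1$). Put on $\mathcal{P}$ the inner product for which distinct monomials are orthogonal and $\|\underline{z}^{\underline{k}}\|^2=\dfrac{k_1!\cdots k_n!}{|\underline{k}|!}$, with $|\underline{k}|=k_1+\cdots+k_n$. $\mathcal{H}'$ is the completion of $\mathcal{P}$, and $S_i'$ is the bounded operator on $\mathcal{H}'$ extending $S_i'f=z_if$, $f\in\mathcal{P}$. The space $\Gamma_q(\mathbb{C}^n)$: let $\{e_1,\ldots,e_n\}$ be the standard basis of $\mathbb{C}^n$,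 $\Gamma(\mathbb{C}^n)=\bigoplus_{m\ge0}(\mathbb{C}^n)^{\otimes m}$ the full Fock space with vacuum $\omega$, and $V_ix=e_i\otimes x$ the left creation operators (with $e_i\otimes\omega=e_i$). For an $n$-tuple $\underline{R}$ of bounded operators on a Hilbert space $\mathcal{M}$, let $\mathcal{M}^q(\underline{R})$ be the largest closed subspace $\mathcal{N}\subseteq\mathcal{M}$ such that every $R_i^*$ leaves $\mathcal{N}$ invariant and $R_i^*R_j^*h=\overline{q_{ij}}R_j^*R_i^*h$ for all $h\in\mathcal{N}$ and all $i,j$ (it exists). Then $\Gamma_q(\mathbb{C}^n)=(\Gamma(\mathbb{C}^n))^q(V_1,\ldots,V_n)$, and $S_i=P_{\Gamma_q(\mathbb{C}^n)}V_i|_{\Gamma_q(\mathbb{C}^n)}$. *)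

theory Defs
  imports "HOL-Analysis.Analysis" "HOL-Library.Poly_Mapping"
begin

section \<open>Complex Hilbert spaces\<close>

text \<open>HOL-Analysis only has real inner product spaces. A complex inner product space is
  rendered as a real one (which supplies norm and topology) with a compatible complex scalar
  multiplication and a sesquilinear \<open>cinner\<close>, conjugate-linear in its first argument, whose real
  part is the given real inner product.\<close>

class complex_inner = real_inner +
  fixes scaleC :: "complex \<Rightarrow> 'a \<Rightarrow> 'a"  (infixr \<open>*\<^sub>C\<close> 75)
    and cinner :: "'a \<Rightarrow> 'a \<Rightarrow> complex"
  assumes scaleC_add_right: "a *\<^sub>C (x + y) = a *\<^sub>C x + a *\<^sub>C y"
    and scaleC_add_left: "(a + b) *\<^sub>C x = a *\<^sub>C x + b *\<^sub>C x"
    and scaleC_scaleC: "a *\<^sub>C b *\<^sub>C x = (a * b) *\<^sub>C x"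
    and scaleR_scaleC: "scaleR r x = complex_of_real r *\<^sub>C x"
    and cinner_commute: "cinner x y = cnj (cinner y x)"
    and cinner_add_left: "cinner (x + y) z = cinner x z + cinner y z"
    and cinner_scaleC_left: "cinner (a *\<^sub>C x) y = cnj a * cinner x y"
    and inner_eq_Re_cinner: "inner x y = Re (cinner x y)"

class chilbert_space = complex_inner + complete_space

global_interpretation complex_vector:
  vector_space "scaleC :: complex \<Rightarrow> 'a \<Rightarrow> 'a::complex_inner"
proof
  fix x :: 'a
  show "1 *\<^sub>C x = x"
    using scaleR_scaleC[of 1 x] by simp
qed (simp_all add: scaleC_add_right scaleC_add_left scaleC_scaleC)

lemma cinner_self: "cinner x x = complex_of_real ((norm x)\<^sup>2)"
proof (rule complex_eqI)
  show "Re (cinner x x) = Re (complex_of_real ((norm x)\<^sup>2))"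
    by (simp flip: inner_eq_Re_cinner add: power2_norm_eq_inner)
  have "Im (cinner x x) = - Im (cinner x x)"
    by (metis cinner_commute cnj.sel(2))
  then show "Im (cinner x x) = Im (complex_of_real ((norm x)\<^sup>2))"
    by simp
qed

definition clinear :: "('a::complex_inner \<Rightarrow> 'b::complex_inner) \<Rightarrow> bool" where
  "clinear T \<longleftrightarrow> Vector_Spaces.linear scaleC scaleC T"

definition bounded_clinear :: "('a::complex_inner \<Rightarrow> 'b::complex_inner) \<Rightarrow> bool" where
  "bounded_clinear T \<longleftrightarrow> clinear T \<and> (\<exists>K. \<forall>x. norm (T x) \<le> K * norm x)"

definition cadjoint :: "('a::complex_inner \<Rightarrow> 'b::complex_inner) \<Rightarrow> 'b \<Rightarrow> 'a" where
  "cadjoint T = (THE G. \<forall>x y. cinner (T x) y = cinner x (G y))"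

definition closed_csubspace :: "'a::complex_inner set \<Rightarrow> bool" where
  "closed_csubspace N \<longleftrightarrow> complex_vector.subspace N \<and> closed N"

definition orth_proj :: "'a::complex_inner set \<Rightarrow> 'a \<Rightarrow> 'a" where
  "orth_proj N x = (THE y. y \<in> N \<and> (\<forall>z\<in>N. cinner z (x - y) = 0))"

definition unitary_onto :: "('a::complex_inner \<Rightarrow> 'b::complex_inner) \<Rightarrow> 'b set \<Rightarrow> bool" where
  "unitary_onto U N \<longleftrightarrow>
     clinear U \<and> (\<forall>x y. cinner (U x) (U y) = cinner x y) \<and> range U = N"


section \<open>Square-summable families\<close>

typedef 'a ell2 = "{f :: 'a \<Rightarrow> complex. (\<lambda>x. (cmod (f x))\<^sup>2) summable_on UNIV}"
  morphisms coord Abs_ell2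
  by (rule exI[of _ "\<lambda>_. 0"]) simp

setup_lifting type_definition_ell2

lemma summable_coord: "(\<lambda>a. (cmod (coord x a))\<^sup>2) summable_on UNIV"
  using coord[of x] by simp

lemma ell2_eqI: "(\<And>a. coord x a = coord y a) \<Longrightarrow> x = y"
  by (simp add: coord_inject[symmetric] ext)

lemma square_summable_add:
  fixes f g :: "'a \<Rightarrow> complex"
  assumes "(\<lambda>x. (cmod (f x))\<^sup>2) summable_on UNIV" "(\<lambda>x. (cmod (g x))\<^sup>2) summable_on UNIV"
  shows "(\<lambda>x. (cmod (f x + g x))\<^sup>2) summable_on UNIV"
proof (rule summable_on_comparison_test)
  show "(\<lambda>x. 2 * (cmod (f x))\<^sup>2 + 2 * (cmod (g x))\<^sup>2) summable_on UNIV"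
    using assms by (intro summable_on_add summable_on_cmult_right)
  fix x
  have "(cmod (f x + g x))\<^sup>2 \<le> (cmod (f x) + cmod (g x))\<^sup>2"
    by (intro power_mono norm_triangle_ineq) auto
  also have "\<dots> \<le> 2 * (cmod (f x))\<^sup>2 + 2 * (cmod (g x))\<^sup>2"
    using sum_squares_bound[of "cmod (f x)" "cmod (g x)"] by (simp add: power2_sum)
  finally show "(cmod (f x + g x))\<^sup>2 \<le> 2 * (cmod (f x))\<^sup>2 + 2 * (cmod (g x))\<^sup>2" .
qed auto

lemma square_summable_scale:
  fixes f :: "'a \<Rightarrow> complex"
  assumes "(\<lambda>x. (cmod (f x))\<^sup>2) summable_on UNIV"
  shows "(\<lambda>x. (cmod (c * f x))\<^sup>2) summable_on UNIV"
  using summable_on_cmult_right[OF assms, of "(cmod c)\<^sup>2"]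
  by (simp add: norm_mult power_mult_distrib)

lemma summable_cnj_mult:
  "(\<lambda>a. cnj (coord x a) * coord y a) summable_on UNIV"
proof (rule abs_summable_summable, rule summable_on_comparison_test)
  show "(\<lambda>a. (cmod (coord x a))\<^sup>2 + (cmod (coord y a))\<^sup>2) summable_on UNIV"
    by (intro summable_on_add summable_coord)
  fix a
  have "2 * (cmod (coord x a) * cmod (coord y a)) \<le> (cmod (coord x a))\<^sup>2 + (cmod (coord y a))\<^sup>2"
    using sum_squares_bound[of "cmod (coord x a)" "cmod (coord y a)"] by simp
  moreover have "0 \<le> cmod (coord x a) * cmod (coord y a)"
    by simp
  ultimately have "cmod (coord x a) * cmod (coord y a)
      \<le> (cmod (coord x a))\<^sup>2 + (cmod (coord y a))\<^sup>2"
    by linarith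
  then show "norm (cnj (coord x a) * coord y a) \<le> (cmod (coord x a))\<^sup>2 + (cmod (coord y a))\<^sup>2"
    by (simp add: norm_mult)
qed auto

instantiation ell2 :: (type) complex_inner
begin

lift_definition zero_ell2 :: "'a ell2" is "\<lambda>_. 0" by simp
lift_definition plus_ell2 :: "'a ell2 \<Rightarrow> 'a ell2 \<Rightarrow> 'a ell2" is "\<lambda>f g x. f x + g x"
  by (rule square_summable_add)
lift_definition scaleC_ell2 :: "complex \<Rightarrow> 'a ell2 \<Rightarrow> 'a ell2" is "\<lambda>c f x. c * f x"
  by (rule square_summable_scale)
lift_definition uminus_ell2 :: "'a ell2 \<Rightarrow> 'a ell2" is "\<lambda>f x. - f x" by simp
lift_definition minus_ell2 :: "'a ell2 \<Rightarrow> 'a ell2 \<Rightarrow> 'a ell2" is "\<lambda>f g x. f x - g x"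
  using square_summable_add[of _ "\<lambda>x. - g x" for g] by fastforce
definition scaleR_ell2 :: "real \<Rightarrow> 'a ell2 \<Rightarrow> 'a ell2" where
  "scaleR_ell2 r x = complex_of_real r *\<^sub>C x"
definition cinner_ell2 :: "'a ell2 \<Rightarrow> 'a ell2 \<Rightarrow> complex" where
  "cinner_ell2 x y = (\<Sum>\<^sub>\<infinity>a. cnj (coord x a) * coord y a)"
definition inner_ell2 :: "'a ell2 \<Rightarrow> 'a ell2 \<Rightarrow> real" where
  "inner_ell2 x y = Re (cinner x y)"
definition norm_ell2 :: "'a ell2 \<Rightarrow> real" where
  "norm_ell2 x = sqrt (inner x x)"
definition sgn_ell2 :: "'a ell2 \<Rightarrow> 'a ell2" where
  "sgn_ell2 x = scaleR (inverse (norm x)) x"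
definition dist_ell2 :: "'a ell2 \<Rightarrow> 'a ell2 \<Rightarrow> real" where
  "dist_ell2 x y = norm (x - y)"
definition uniformity_ell2 :: "('a ell2 \<times> 'a ell2) filter" where
  "uniformity_ell2 = (INF e\<in>{0<..}. principal {(x, y). dist x y < e})"
definition open_ell2 :: "'a ell2 set \<Rightarrow> bool" where
  "open_ell2 U \<longleftrightarrow> (\<forall>x\<in>U. eventually (\<lambda>(x', y). x' = x \<longrightarrow> y \<in> U) uniformity)"

lemmas coord_simps = plus_ell2.rep_eq zero_ell2.rep_eq scaleC_ell2.rep_eq uminus_ell2.rep_eq
  minus_ell2.rep_eq

lemma inner_self_ell2: "inner x x = (\<Sum>\<^sub>\<infinity>a. (cmod (coord x a))\<^sup>2)" for x :: "'a ell2"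
proof -
  have "cnj z * z = complex_of_real ((cmod z)\<^sup>2)" for z
    by (metis complex_norm_square mult.commute)
  then show ?thesis
    using infsum_Re[OF summable_cnj_mult[of x x]] by (simp add: inner_ell2_def cinner_ell2_def)
qed

instance
proof
  fix x y z :: "'a ell2" and a b :: complex and r s :: real
  show "x + y + z = x + (y + z)" "x + y = y + x" "0 + x = x" "- x + x = 0" "x - y = x + - y"
    by (rule ell2_eqI; simp add: coord_simps)+
  show "a *\<^sub>C (x + y) = a *\<^sub>C x + a *\<^sub>C y" "(a + b) *\<^sub>C x = a *\<^sub>C x + b *\<^sub>C x"
    "a *\<^sub>C b *\<^sub>C x = (a * b) *\<^sub>C x"
    by (rule ell2_eqI; simp add: coord_simps algebra_simps)+
  show "r *\<^sub>R (x + y) = r *\<^sub>R x + r *\<^sub>R y" "(r + s) *\<^sub>R x = r *\<^sub>R x + s *\<^sub>R x"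
    "r *\<^sub>R s *\<^sub>R x = (r * s) *\<^sub>R x" "1 *\<^sub>R x = x"
    by (rule ell2_eqI; simp add: scaleR_ell2_def coord_simps algebra_simps)+
  show "r *\<^sub>R x = complex_of_real r *\<^sub>C x"
    by (rule scaleR_ell2_def)
  show cc: "cinner x y = cnj (cinner y x)" for x y :: "'a ell2"
    by (simp add: cinner_ell2_def mult.commute flip: infsum_cnj)
  show ca: "cinner (x + y) z = cinner x z + cinner y z"
    unfolding cinner_ell2_def
    by (subst infsum_add[symmetric]) (simp_all add: summable_cnj_mult coord_simps distrib_right)
  show cs: "cinner (a *\<^sub>C x) y = cnj a * cinner x y" for a
    unfolding cinner_ell2_def
    by (subst infsum_cmult_right[symmetric])
      (simp_all add: summable_cnj_mult coord_simps mult.assoc)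
  show "inner x y = Re (cinner x y)"
    by (rule inner_ell2_def)
  show "inner x y = inner y x"
    using cc[of x y] by (simp add: inner_ell2_def)
  show "inner (x + y) z = inner x z + inner y z"
    by (simp add: inner_ell2_def ca)
  show "inner (r *\<^sub>R x) y = r * inner x y"
    by (simp add: inner_ell2_def cs scaleR_ell2_def)
  show "0 \<le> inner x x"
    by (simp add: inner_self_ell2 infsum_nonneg)
  show "inner x x = 0 \<longleftrightarrow> x = 0"
  proof
    assume "inner x x = 0"
    then have "(cmod (coord x a))\<^sup>2 = 0" for a
      using nonneg_infsum_le_0D[OF _ summable_coord[of x], of a]
      by (simp add: inner_self_ell2)
    then show "x = 0"
      by (intro ell2_eqI) (simp add: coord_simps)
  next
    assume "x = 0"
    then show "inner x x = 0"
      by (simp add: inner_self_ell2 coord_simps)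
  qed
  show "norm x = sqrt (inner x x)" by (rule norm_ell2_def)
  show "sgn x = scaleR (inverse (norm x)) x" by (rule sgn_ell2_def)
  show "dist x y = norm (x - y)" by (rule dist_ell2_def)
  show "(uniformity :: ('a ell2 \<times> 'a ell2) filter)
      = (INF e\<in>{0<..}. principal {(x, y). dist x y < e})"
    by (rule uniformity_ell2_def)
  show "open U \<longleftrightarrow> (\<forall>x\<in>U. eventually (\<lambda>(x', y). x' = x \<longrightarrow> y \<in> U) uniformity)"
    for U :: "'a ell2 set"
    by (rule open_ell2_def)
qed

end

lemma norm_ell2_square: "(norm x)\<^sup>2 = (\<Sum>\<^sub>\<infinity>a. (cmod (coord x a))\<^sup>2)" for x :: "'a ell2"
  by (subst power2_norm_eq_inner) (rule inner_self_ell2)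

lemma sum_coord_le_norm:
  assumes "finite F"
  shows "(\<Sum>a\<in>F. (cmod (coord x a))\<^sup>2) \<le> (norm x)\<^sup>2"
  unfolding norm_ell2_square
  by (rule finite_sum_le_infsum[OF summable_coord assms]) simp_all

lemma coord_le_norm: "cmod (coord x a) \<le> norm x"
proof (rule power2_le_imp_le)
  show "(cmod (coord x a))\<^sup>2 \<le> (norm x)\<^sup>2"
    using sum_coord_le_norm[of "{a}" x] by simp
qed simp

instance ell2 :: (type) chilbert_space
proof
  fix X :: "nat \<Rightarrow> 'a ell2"
  assume X: "Cauchy X"
  have "Cauchy (\<lambda>n. coord (X n) a)" for a
  proof (rule metric_CauchyI)
    fix e :: real assume "e > 0"
    then obtain M where M: "\<And>m n. m \<ge> M \<Longrightarrow> n \<ge> M \<Longrightarrow> dist (X m) (X n) < e"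
      using metric_CauchyD[OF X] by blast
    have "dist (coord (X m) a) (coord (X n) a) < e" if "m \<ge> M" "n \<ge> M" for m n
      using M[OF that] coord_le_norm[of "X m - X n" a] by (simp add: dist_norm coord_simps)
    then show "\<exists>M. \<forall>m\<ge>M. \<forall>n\<ge>M. dist (coord (X m) a) (coord (X n) a) < e"
      by blast
  qed
  then have "\<exists>l. (\<lambda>n. coord (X n) a) \<longlonglongrightarrow> l" for a
    by (simp add: Cauchy_convergent_iff convergent_def)
  then obtain L where L: "\<And>a. (\<lambda>n. coord (X n) a) \<longlonglongrightarrow> L a"
    by metis
  have fin: "\<exists>M. \<forall>n\<ge>M. \<forall>F. finite F \<longrightarrow> (\<Sum>a\<in>F. (cmod (coord (X n) a - L a))\<^sup>2) \<le> e\<^sup>2"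
    if "e > 0" for e :: real
  proof -
    obtain M where M: "\<And>m n. m \<ge> M \<Longrightarrow> n \<ge> M \<Longrightarrow> dist (X m) (X n) < e"
      using metric_CauchyD[OF X \<open>e > 0\<close>] by blast
    have "(\<Sum>a\<in>F. (cmod (coord (X n) a - L a))\<^sup>2) \<le> e\<^sup>2" if "n \<ge> M" "finite F" for n F
    proof (rule tendsto_upperbound)
      show "(\<lambda>m. \<Sum>a\<in>F. (cmod (coord (X n) a - coord (X m) a))\<^sup>2)
          \<longlonglongrightarrow> (\<Sum>a\<in>F. (cmod (coord (X n) a - L a))\<^sup>2)"
        by (intro tendsto_intros L)
      show "\<forall>\<^sub>F m in sequentially. (\<Sum>a\<in>F. (cmod (coord (X n) a - coord (X m) a))\<^sup>2) \<le> e\<^sup>2"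
      proof (rule eventually_sequentiallyI)
        fix m assume "m \<ge> M"
        have "(\<Sum>a\<in>F. (cmod (coord (X n) a - coord (X m) a))\<^sup>2) \<le> (norm (X n - X m))\<^sup>2"
          using sum_coord_le_norm[OF \<open>finite F\<close>, of "X n - X m"] by (simp add: coord_simps)
        also have "\<dots> \<le> e\<^sup>2"
          using M[OF \<open>n \<ge> M\<close> \<open>m \<ge> M\<close>] by (intro power_mono) (auto simp: dist_norm)
        finally show "(\<Sum>a\<in>F. (cmod (coord (X n) a - coord (X m) a))\<^sup>2) \<le> e\<^sup>2" .
      qed
    qed simp
    then show ?thesis by blast
  qed
  have summ: "(\<lambda>a. (cmod (coord (X n) a - L a))\<^sup>2) summable_on UNIV"
    if "\<forall>F. finite F \<longrightarrow> (\<Sum>a\<in>F. (cmod (coord (X n) a - L a))\<^sup>2) \<le> e\<^sup>2" for n e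
    using that by (intro nonneg_bdd_above_summable_on bdd_aboveI[of _ "e\<^sup>2"]) auto
  obtain n where n: "\<forall>F. finite F \<longrightarrow> (\<Sum>a\<in>F. (cmod (coord (X n) a - L a))\<^sup>2) \<le> 1\<^sup>2"
    using fin[of 1] by auto
  have "(\<lambda>a. (cmod (- 1 * (coord (X n) a - L a) + coord (X n) a))\<^sup>2) summable_on UNIV"
    by (rule square_summable_add[OF square_summable_scale[OF summ[OF n]] summable_coord])
  then have "(\<lambda>a. (cmod (L a))\<^sup>2) summable_on UNIV"
    by simp
  then have cL: "coord (Abs_ell2 L) = L"
    by (simp add: Abs_ell2_inverse)
  have "X \<longlonglongrightarrow> Abs_ell2 L"
  proof (rule metric_LIMSEQ_I)
    fix e :: real assume "e > 0"
    then obtain M where M: "\<And>n F. n \<ge> M \<Longrightarrow> finite F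
        \<Longrightarrow> (\<Sum>a\<in>F. (cmod (coord (X n) a - L a))\<^sup>2) \<le> (e/2)\<^sup>2"
      using fin[of "e/2"] by auto
    have "dist (X n) (Abs_ell2 L) < e" if "n \<ge> M" for n
    proof -
      have "(norm (X n - Abs_ell2 L))\<^sup>2 \<le> (e/2)\<^sup>2"
        unfolding norm_ell2_square coord_simps cL
        using M[OF that] summ[of n "e/2"] by (intro infsum_le_finite_sums) auto
      then have "norm (X n - Abs_ell2 L) \<le> e/2"
        by (rule power2_le_imp_le) (use \<open>e > 0\<close> in auto)
      then show ?thesis
        using \<open>e > 0\<close> by (simp add: dist_norm)
    qed
    then show "\<exists>no. \<forall>n\<ge>no. dist (X n) (Abs_ell2 L) < e"
      by blast
  qed
  then show "convergent X"
    by (auto simp: convergent_def)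
qed


section \<open>Polynomials in \<open>q\<close>-commuting variables\<close>

text \<open>The variables are indexed by a finite linearly ordered type \<open>'n\<close>. A polynomial is its
  finitely supported family of coefficients with respect to the ordered monomials
  \<open>z\<^sup>k = z\<^sub>1\<^bsup>k\<^sub>1\<^esup> \<dots> z\<^sub>n\<^bsup>k\<^sub>n\<^esup>\<close>. The library's \<open>*\<close> on this type is the commutative product; the
  product of the \<open>q\<close>-commuting variables is \<open>qmult\<close>.\<close>

type_synonym 'n qpoly = "('n \<Rightarrow>\<^sub>0 nat) \<Rightarrow>\<^sub>0 complex"

text \<open>Reordering \<open>z\<^sup>k z\<^sup>l\<close> moves each \<open>z\<^sub>i\<close> of \<open>z\<^sup>l\<close> to the left past the \<open>z\<^sub>j\<close> (\<open>i < j\<close>) of \<open>z\<^sup>k\<close>,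
  each such step being \<open>z\<^sub>j z\<^sub>i = q\<^sub>i\<^sub>j z\<^sub>i z\<^sub>j\<close>.\<close>

definition qtwist :: "('n::{finite,linorder} \<Rightarrow> 'n \<Rightarrow> complex) \<Rightarrow> ('n \<Rightarrow>\<^sub>0 nat) \<Rightarrow> ('n \<Rightarrow>\<^sub>0 nat) \<Rightarrow> complex"
  where "qtwist q k l =
    (\<Prod>(i, j)\<in>{(i, j). i < j}. q i j ^ (Poly_Mapping.lookup k j * Poly_Mapping.lookup l i))"

definition qmult :: "('n::{finite,linorder} \<Rightarrow> 'n \<Rightarrow> complex) \<Rightarrow> 'n qpoly \<Rightarrow> 'n qpoly \<Rightarrow> 'n qpoly"
  where "qmult q f g = (\<Sum>k\<in>Poly_Mapping.keys f. \<Sum>l\<in>Poly_Mapping.keys g.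
    Poly_Mapping.single (k + l)
      (Poly_Mapping.lookup f k * Poly_Mapping.lookup g l * qtwist q k l))"

definition qscale :: "complex \<Rightarrow> 'n qpoly \<Rightarrow> 'n qpoly" where
  "qscale c f = Poly_Mapping.map ((*) c) f"

definition qmonom :: "('n \<Rightarrow>\<^sub>0 nat) \<Rightarrow> 'n qpoly" where
  "qmonom k = Poly_Mapping.single k 1"

definition qvar :: "'n \<Rightarrow> 'n qpoly" where
  "qvar i = qmonom (Poly_Mapping.single i 1)"

definition monom_weight :: "('n::finite \<Rightarrow>\<^sub>0 nat) \<Rightarrow> real" where
  "monom_weight k =
    (\<Prod>i\<in>UNIV. fact (Poly_Mapping.lookup k i)) / fact (\<Sum>i\<in>UNIV. Poly_Mapping.lookup k i)"

definition qpoly_inner :: "'n::finite qpoly \<Rightarrow> 'n qpoly \<Rightarrow> complex" where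
  "qpoly_inner f g = (\<Sum>k\<in>Poly_Mapping.keys f \<inter> Poly_Mapping.keys g.
     complex_of_real (monom_weight k) * (cnj (Poly_Mapping.lookup f k) * Poly_Mapping.lookup g k))"

text \<open>\<open>qmult\<close> is the associative unital product determined by the \<open>q\<close>-commutation relations, and
  \<open>qmonom k\<close> is the ordered monomial \<open>z\<^sup>k\<close>.\<close>

lemma qmult_superset:
  assumes "finite A" "finite B" "Poly_Mapping.keys f \<subseteq> A" "Poly_Mapping.keys g \<subseteq> B"
  shows "qmult q f g = (\<Sum>k\<in>A. \<Sum>l\<in>B. Poly_Mapping.single (k + l)
      (Poly_Mapping.lookup f k * Poly_Mapping.lookup g l * qtwist q k l))"
proof -
  have "(\<Sum>l\<in>Poly_Mapping.keys g. Poly_Mapping.single (k + l)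
      (Poly_Mapping.lookup f k * Poly_Mapping.lookup g l * qtwist q k l))
    = (\<Sum>l\<in>B. Poly_Mapping.single (k + l)
      (Poly_Mapping.lookup f k * Poly_Mapping.lookup g l * qtwist q k l))" for k
    using assms by (intro sum.mono_neutral_left) (auto simp: in_keys_iff)
  then show ?thesis
    unfolding qmult_def using assms
    by (simp, intro sum.mono_neutral_left) (auto simp: in_keys_iff)
qed

lemma qmult_add_left: "qmult q (f + g) h = qmult q f h + qmult q g h"
proof -
  let ?A = "Poly_Mapping.keys f \<union> Poly_Mapping.keys g" and ?B = "Poly_Mapping.keys h"
  note * = qmult_superset[of ?A ?B _ h q]
  show ?thesis
    by (subst (1 2 3) *) (simp_all add: keys_add lookup_add distrib_left distrib_right single_add sum.distrib)
qed

lemma qmult_add_right: "qmult q h (f + g) = qmult q h f + qmult q h g"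
proof -
  let ?A = "Poly_Mapping.keys f \<union> Poly_Mapping.keys g" and ?B = "Poly_Mapping.keys h"
  note * = qmult_superset[of ?B ?A h _ q]
  show ?thesis
    by (subst (1 2 3) *) (simp_all add: keys_add lookup_add distrib_left distrib_right single_add sum.distrib)
qed

lemma qmult_zero [simp]: "qmult q 0 f = 0" "qmult q f 0 = 0"
  by (simp_all add: qmult_def)

lemma qmult_sum_left: "qmult q (\<Sum>a\<in>A. f a) g = (\<Sum>a\<in>A. qmult q (f a) g)"
  by (induction A rule: infinite_finite_induct) (simp_all add: qmult_add_left)

lemma qmult_sum_right: "qmult q g (\<Sum>a\<in>A. f a) = (\<Sum>a\<in>A. qmult q g (f a))"
  by (induction A rule: infinite_finite_induct) (simp_all add: qmult_add_right)

lemma qmult_single: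
  "qmult q (Poly_Mapping.single k a) (Poly_Mapping.single l b)
     = Poly_Mapping.single (k + l) (a * b * qtwist q k l)"
  by (subst qmult_superset[of "{k}" "{l}"]) (simp_all)

lemma qpoly_eq_sum:
  "f = (\<Sum>k\<in>Poly_Mapping.keys f. Poly_Mapping.single k (Poly_Mapping.lookup f k))"
  for f :: "'n qpoly"
  by (rule poly_mapping_eqI) (simp add: lookup_sum lookup_single when_def in_keys_iff sum.delta')

lemma qtwist_add_left: "qtwist q (k + l) m = qtwist q k m * qtwist q l m"
  unfolding qtwist_def prod.distrib[symmetric]
  by (intro prod.cong) (auto simp: lookup_add distrib_left distrib_right power_add)

lemma qtwist_add_right: "qtwist q k (l + m) = qtwist q k l * qtwist q k m"
  unfolding qtwist_def prod.distrib[symmetric]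
  by (intro prod.cong) (auto simp: lookup_add distrib_left distrib_right power_add)

lemma qtwist_zero [simp]: "qtwist q 0 k = 1" "qtwist q k 0 = 1"
  by (simp_all add: qtwist_def case_prod_beta)

lemma qmult_assoc: "qmult q (qmult q f g) h = qmult q f (qmult q g h)"
proof -
  have "qmult q (qmult q (Poly_Mapping.single k a) (Poly_Mapping.single l b)) (Poly_Mapping.single m c)
      = qmult q (Poly_Mapping.single k a) (qmult q (Poly_Mapping.single l b) (Poly_Mapping.single m c))"
    for k l m a b c
    by (simp add: qmult_single qtwist_add_left qtwist_add_right algebra_simps)
  then show ?thesis
    by (subst (1 2) qpoly_eq_sum[of f], subst (1 2) qpoly_eq_sum[of g], subst (1 2) qpoly_eq_sum[of h])
      (simp add: qmult_sum_left qmult_sum_right)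
qed

lemma qmult_one: "qmult q (qmonom 0) f = f" "qmult q f (qmonom 0) = f"
proof -
  have "qmult q (qmonom 0) (Poly_Mapping.single k a) = Poly_Mapping.single k a"
    and "qmult q (Poly_Mapping.single k a) (qmonom 0) = Poly_Mapping.single k a" for k a
    by (simp_all add: qmonom_def qmult_single del: single_one)
  then show "qmult q (qmonom 0) f = f" "qmult q f (qmonom 0) = f"
    by (subst (1 2) qpoly_eq_sum[of f], simp add: qmult_sum_left qmult_sum_right)+
qed

lemma qtwist_single:
  "qtwist q (Poly_Mapping.single j a) (Poly_Mapping.single i b) = (if i < j then q i j ^ (a * b) else 1)"
proof -
  have "qtwist q (Poly_Mapping.single j a) (Poly_Mapping.single i b)
      = (\<Prod>p\<in>{(i, j). i < j}. if p = (i, j) then q i j ^ (a * b) else 1)"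
    unfolding qtwist_def by (intro prod.cong) (auto simp: lookup_single when_def split: if_splits)
  then show ?thesis
    by (simp add: prod.delta)
qed

lemma qvar_commute:
  assumes "\<And>i. q i i = 1" "\<And>i j. q j i = inverse (q i j)" "\<And>i j. cmod (q i j) = 1"
  shows "qmult q (qvar j) (qvar i) = qscale (q i j) (qmult q (qvar i) (qvar j))"
proof -
  have "q i j \<noteq> 0"
    using assms(3)[of i j] by auto
  then have "q i j * q j i = 1"
    using assms(2)[of i j] by simp
  then show ?thesis
    using assms(1)
    by (cases i j rule: linorder_cases)
      (auto simp: qvar_def qmonom_def qmult_single qtwist_single qscale_def add.commute)
qed

lemma qvar_power:
  "(qmult q (qvar i) ^^ a) (qmonom 0) = qmonom (Poly_Mapping.single i a)"
  by (induction a)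
    (simp_all add: qvar_def qmonom_def qmult_single qtwist_single single_add[symmetric])

lemma qmonom_ordered:
  "foldr (\<lambda>i. qmult q ((qmult q (qvar i) ^^ Poly_Mapping.lookup k i) (qmonom 0)))
     (sorted_list_of_set UNIV) (qmonom 0) = qmonom k"
proof -
  have "foldr (\<lambda>i. qmult q ((qmult q (qvar i) ^^ Poly_Mapping.lookup k i) (qmonom 0))) xs (qmonom 0)
      = qmonom (\<Sum>i\<leftarrow>xs. Poly_Mapping.single i (Poly_Mapping.lookup k i))"
    if "sorted_wrt (<) xs" for xs
    using that
  proof (induction xs)
    case (Cons i xs)
    have "qtwist q (Poly_Mapping.single i a) (\<Sum>j\<leftarrow>ys. Poly_Mapping.single j (c j)) = 1"
      if "\<forall>j\<in>set ys. i < j" for ys c a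
      using that
      by (induction ys) (auto simp: qtwist_add_right qtwist_single)
    then show ?case
      using Cons by (simp add: qvar_power) (simp add: qmonom_def qmult_single)
  qed simp
  moreover have "(\<Sum>i\<leftarrow>sorted_list_of_set UNIV. Poly_Mapping.single i (Poly_Mapping.lookup k i)) = k"
  proof -
    have "(\<Sum>i\<leftarrow>sorted_list_of_set UNIV. Poly_Mapping.single i (Poly_Mapping.lookup k i))
        = (\<Sum>i\<in>UNIV. Poly_Mapping.single i (Poly_Mapping.lookup k i))"
      by (subst sum.distinct_set_conv_list[symmetric]) auto
    also have "\<dots> = k"
      by (rule poly_mapping_eqI) (simp add: lookup_sum lookup_single when_def)
    finally show ?thesis .
  qed
  ultimately show ?thesis
    by simp
qed


section \<open>The space \<open>H'\<close> and its multiplication operators\<close>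

text \<open>A completion of the inner product space of polynomials: a Hilbert space \<open>'h\<close> with an
  isometric linear embedding \<open>J\<close> of dense range; unique up to a unitary compatible with \<open>J\<close>.\<close>

definition qpoly_completion :: "('n::finite qpoly \<Rightarrow> 'h::chilbert_space) \<Rightarrow> bool" where
  "qpoly_completion J \<longleftrightarrow>
     (\<forall>f g. J (f + g) = J f + J g) \<and> (\<forall>c f. J (qscale c f) = c *\<^sub>C J f) \<and>
     (\<forall>f g. cinner (J f) (J g) = qpoly_inner f g) \<and> closure (range J) = UNIV"

definition qmult_op ::
  "('n::{finite,linorder} \<Rightarrow> 'n \<Rightarrow> complex) \<Rightarrow> ('n qpoly \<Rightarrow> 'h::chilbert_space) \<Rightarrow> 'n \<Rightarrow> 'h \<Rightarrow> 'h"
  where "qmult_op q J i = (THE T. bounded_clinear T \<and> (\<forall>f. T (J f) = J (qmult q (qvar i) f)))"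

lemma monom_weight_pos: "monom_weight k > 0"
  by (simp add: monom_weight_def prod_pos)

lemma qpoly_completion_exists:
  "\<exists>J :: 'n::finite qpoly \<Rightarrow> ('n \<Rightarrow>\<^sub>0 nat) ell2. qpoly_completion J"
proof -
  define s :: "('n \<Rightarrow>\<^sub>0 nat) \<Rightarrow> complex" where "s k = complex_of_real (sqrt (monom_weight k))" for k
  define J :: "'n qpoly \<Rightarrow> ('n \<Rightarrow>\<^sub>0 nat) ell2" where
    "J f = Abs_ell2 (\<lambda>k. s k * Poly_Mapping.lookup f k)" for f
  have s: "s k \<noteq> 0" "cnj (s k) = s k" "s k * s k = complex_of_real (monom_weight k)" for k
    using monom_weight_pos[of k] by (simp_all add: s_def flip: of_real_mult)
  have cJ: "coord (J f) k = s k * Poly_Mapping.lookup f k" for f k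
  proof -
    have "(\<lambda>k. (cmod (s k * Poly_Mapping.lookup f k))\<^sup>2) summable_on UNIV"
      by (rule finite_nonzero_values_imp_summable_on)
        (rule finite_subset[OF _ finite_keys[of f]], auto simp: in_keys_iff)
    then show ?thesis
      by (simp add: J_def Abs_ell2_inverse)
  qed
  have "J (f + g) = J f + J g" for f g
    by (rule ell2_eqI) (simp add: cJ coord_simps lookup_add algebra_simps)
  moreover have "J (qscale c f) = c *\<^sub>C J f" for c f
    by (rule ell2_eqI)
      (simp add: cJ coord_simps qscale_def Poly_Mapping.map.rep_eq when_def algebra_simps)
  moreover have "cinner (J f) (J g) = qpoly_inner f g" for f g
  proof -
    have *: "cnj (coord (J f) k) * coord (J g) k = complex_of_real (monom_weight k) *
        (cnj (Poly_Mapping.lookup f k) * Poly_Mapping.lookup g k)" for k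
      by (simp add: cJ s flip: s(3))
    have "cinner (J f) (J g) = (\<Sum>\<^sub>\<infinity>k\<in>Poly_Mapping.keys f \<inter> Poly_Mapping.keys g.
        complex_of_real (monom_weight k) * (cnj (Poly_Mapping.lookup f k) * Poly_Mapping.lookup g k))"
      unfolding cinner_ell2_def *
      by (rule infsum_cong_neutral) (auto simp: in_keys_iff)
    then show ?thesis
      by (simp add: qpoly_inner_def)
  qed
  moreover have "closure (range J) = UNIV"
  proof -
    have "x \<in> closure (range J)" for x
    proof (subst closure_approachable, intro allI impI)
      fix e :: real assume "e > 0"
      obtain F where F: "finite F"
        and Fe: "dist (\<Sum>k\<in>F. (cmod (coord x k))\<^sup>2) (\<Sum>\<^sub>\<infinity>k. (cmod (coord x k))\<^sup>2) \<le> e\<^sup>2 / 4"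
        using infsum_finite_approximation[OF summable_coord[of x], of "e\<^sup>2 / 4"] \<open>e > 0\<close> by auto
      define f :: "'n qpoly" where "f = (\<Sum>k\<in>F. Poly_Mapping.single k (coord x k / s k))"
      have f: "coord (J f) k = (if k \<in> F then coord x k else 0)" for k
        using F by (simp add: cJ f_def lookup_sum lookup_single when_def s sum.delta')
      have "(norm (J f - x))\<^sup>2 = (\<Sum>\<^sub>\<infinity>k\<in>UNIV - F. (cmod (coord x k))\<^sup>2)"
        unfolding norm_ell2_square coord_simps f by (rule infsum_cong_neutral) auto
      also have "\<dots> = (\<Sum>\<^sub>\<infinity>k. (cmod (coord x k))\<^sup>2) - (\<Sum>k\<in>F. (cmod (coord x k))\<^sup>2)"
        using F by (subst infsum_Diff) (auto simp: summable_coord)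
      also have "\<dots> \<le> e\<^sup>2 / 4"
        using Fe unfolding dist_real_def by linarith
      also have "\<dots> = (e / 2)\<^sup>2"
        by (simp add: power2_eq_square)
      finally have "norm (J f - x) \<le> e / 2"
        by (rule power2_le_imp_le) (use \<open>e > 0\<close> in auto)
      then have "dist (J f) x < e"
        using \<open>e > 0\<close> by (simp add: dist_norm)
      then show "\<exists>y\<in>range J. dist y x < e"
        by blast
    qed
    then show ?thesis by blast
  qed
  ultimately show ?thesis
    unfolding qpoly_completion_def by blast
qed


section \<open>The full Fock space and the space \<open>\<Gamma>\<^sub>q\<close>\<close>

text \<open>The words of length \<open>m\<close> index the orthonormal basis \<open>e\<^sub>w\<^sub>1 \<otimes> \<dots> \<otimes> e\<^sub>w\<^sub>m\<close> of the \<open>m\<close>-th tensor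
  power, the empty word being the vacuum.\<close>

type_synonym 'n fock = "'n list ell2"

lift_definition creation :: "complex ^ 'n::finite \<Rightarrow> 'n fock \<Rightarrow> 'n fock"
  is "\<lambda>v f w. case w of [] \<Rightarrow> 0 | i # u \<Rightarrow> v $ i * f u"
proof -
  fix v :: "complex ^ 'n" and f :: "'n list \<Rightarrow> complex"
  let ?g = "\<lambda>w. (cmod (case w of [] \<Rightarrow> 0 | i # u \<Rightarrow> v $ i * f u))\<^sup>2"
  assume f: "(\<lambda>x. (cmod (f x))\<^sup>2) summable_on UNIV"
  have "?g summable_on range ((#) i)" for i
    using square_summable_scale[OF f, of "v $ i"]
    by (subst summable_on_reindex) (auto simp: o_def)
  then have "?g summable_on (\<Union>i. range ((#) i))"
    by (intro summable_on_finite_union_disjoint) auto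
  then have "?g summable_on insert [] (\<Union>i. range ((#) i))"
    by (simp only: summable_on_insert_iff)
  moreover have "insert [] (\<Union>i. range ((#) i)) = (UNIV :: 'n list set)"
    by (auto simp: image_iff) (metis neq_Nil_conv)
  ultimately show "?g summable_on UNIV"
    by simp
qed

definition left_creation :: "'n::finite \<Rightarrow> 'n fock \<Rightarrow> 'n fock" where
  "left_creation i = creation (axis i 1)"

text \<open>\<open>Greatest\<close> is taken with respect to inclusion.\<close>

definition max_q_subspace ::
  "('n \<Rightarrow> 'n \<Rightarrow> complex) \<Rightarrow> ('n \<Rightarrow> 'm \<Rightarrow> 'm) \<Rightarrow> 'm::chilbert_space set" where
  "max_q_subspace q R = (GREATEST N. closed_csubspace N \<and>
     (\<forall>i. \<forall>h\<in>N. cadjoint (R i) h \<in> N) \<and>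
     (\<forall>h\<in>N. \<forall>i j. cadjoint (R i) (cadjoint (R j) h)
                  = cnj (q i j) *\<^sub>C cadjoint (R j) (cadjoint (R i) h)))"

definition qfock :: "('n::finite \<Rightarrow> 'n \<Rightarrow> complex) \<Rightarrow> 'n fock set" where
  "qfock q = max_q_subspace q left_creation"

text \<open>Only the values of \<open>qshift q i\<close> on \<open>qfock q\<close> are relevant.\<close>

definition qshift :: "('n::finite \<Rightarrow> 'n \<Rightarrow> complex) \<Rightarrow> 'n \<Rightarrow> 'n fock \<Rightarrow> 'n fock" where
  "qshift q i x = orth_proj (qfock q) (left_creation i x)"

end

theory Submission
  imports Defs "HOL-Combinatorics.Multiset_Permutations"
begin

text \<open>
  Every word \<open>w = w\<^sub>1 \<dots> w\<^sub>m\<close> gives a product \<open>z\<^sub>w\<^sub>1 \<dots> z\<^sub>w\<^sub>m\<close> of variables, and the commutation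
  relations bring it into the form \<open>t(w) z\<^sup>k\<close>, where \<open>k\<close> counts the letters of \<open>w\<close> and \<open>t(w)\<close> has
  modulus one (\<open>reorder\<close>). The space \<open>\<Gamma>\<^sub>q\<close> consists of the vectors \<open>h\<close> for which \<open>t(w) h(w)\<close> depends
  only on \<open>k\<close>: the relations that define it say that exchanging two adjacent letters
  changes \<open>h\<close> in the way opposite to \<open>t\<close>, and such exchanges generate all rearrangements
  (\<open>qfock_eq_q_symmetric\<close>).

  The unitary sends \<open>z\<^sup>k\<close> to the vector with coefficients \<open>cnj (t(w)) \<parallel>z\<^sup>k\<parallel>\<^sup>2\<close> at the words of letter
  count \<open>k\<close>. There are \<open>|k|! / (k\<^sub>1! \<dots> k\<^sub>n!) = 1 / \<parallel>z\<^sup>k\<parallel>\<^sup>2\<close> such words (\<open>monom_weight_card\<close>), so the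
  squared norm of the image is again \<open>\<parallel>z\<^sup>k\<parallel>\<^sup>2\<close>. For the same reason the inner product of this image
  with any \<open>h\<close> in \<open>\<Gamma>\<^sub>q\<close> is \<open>t(w) h(w)\<close>, for any one of these words (\<open>cinner_to_fock_qmonom\<close>). This
  single formula shows that the isometry is onto \<open>\<Gamma>\<^sub>q\<close>, because a vector orthogonal to all the images
  vanishes, and that it intertwines the operators: the adjoint of creation
  replaces \<open>h(w)\<close> by \<open>h(i w)\<close>, and \<open>t(i w)\<close> differs from \<open>t(w)\<close> by precisely the factor by which
  \<open>z\<^sub>i z\<^sup>k\<close> differs from its ordered monomial (\<open>compressed_creation_qmonom\<close>).
\<close>

section \<open>Orthogonal projection in complex Hilbert spaces\<close>

lemma cinner_add_right: "cinner x (y + z) = cinner x y + cinner x z"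
  by (metis cinner_add_left cinner_commute complex_cnj_add)

lemma cinner_scaleC_right: "cinner x (a *\<^sub>C y) = a * cinner x y"
  by (metis cinner_commute cinner_scaleC_left complex_cnj_cnj complex_cnj_mult)

lemma cinner_diff_right: "cinner x (y - z) = cinner x y - cinner x z"
  by (metis add_diff_cancel cinner_add_right diff_add_cancel)

lemma cinner_conv_inner: "cinner x y = Complex (inner x y) (inner (\<i> *\<^sub>C x) y)"
  by (rule complex_eqI) (simp_all add: inner_eq_Re_cinner cinner_scaleC_left)

lemma cinner_eqI: "(\<And>x. cinner x y = cinner x z) \<Longrightarrow> y = z"
  using cinner_self[of "y - z"] by (simp add: cinner_diff_right)

lemma continuous_on_cinner_right [continuous_intros]:
  assumes "continuous_on S f"
  shows "continuous_on S (\<lambda>x. cinner a (f x))"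
  unfolding cinner_conv_inner Complex_eq by (intro continuous_intros assms)

lemma clinear_iff:
  "clinear T \<longleftrightarrow> (\<forall>x y. T (x + y) = T x + T y) \<and> (\<forall>c x. T (c *\<^sub>C x) = c *\<^sub>C T x)"
  unfolding clinear_def Vector_Spaces.linear_iff
  by (simp add: complex_vector.vector_space_axioms)

lemma clinear_imp_linear: "clinear T \<Longrightarrow> linear T"
  by (rule linearI) (auto simp: clinear_iff scaleR_scaleC)

lemma clinear_diff: "clinear T \<Longrightarrow> T (x - y) = T x - T y"
  using linear_diff[OF clinear_imp_linear] .

lemma clinear_sum: "clinear T \<Longrightarrow> T (sum f A) = (\<Sum>a\<in>A. T (f a))"
  using linear_sum[OF clinear_imp_linear] .

lemma bounded_clinear_continuous_on:
  assumes "bounded_clinear T"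
  shows "continuous_on S T"
proof -
  obtain K where "clinear T" and K: "\<And>x. norm (T x) \<le> K * norm x"
    using assms unfolding bounded_clinear_def by blast
  then interpret linear T
    by (simp add: clinear_imp_linear)
  have "bounded_linear T"
    by unfold_locales (use K in \<open>auto simp: mult.commute\<close>)
  then show ?thesis
    by (simp add: linear_continuous_on)
qed

lemma clinear_isometry_cinner:
  assumes "clinear U" and iso: "\<And>x. norm (U x) = norm x"
  shows "cinner (U x) (U y) = cinner x y"
proof -
  have "inner (U x) (U y) = inner x y" for x y
    using iso[of "x + y"] iso[of x] iso[of y] \<open>clinear U\<close>
    by (simp add: dot_norm clinear_iff)
  then show ?thesis
    using \<open>clinear U\<close> by (metis cinner_conv_inner clinear_iff)
qed

lemma closed_csubspaceD:
  assumes "closed_csubspace N"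
  shows "0 \<in> N" "x \<in> N \<Longrightarrow> y \<in> N \<Longrightarrow> x + y \<in> N" "x \<in> N \<Longrightarrow> y \<in> N \<Longrightarrow> x - y \<in> N"
    "x \<in> N \<Longrightarrow> c *\<^sub>C x \<in> N" "closed N"
  using assms complex_vector.subspace_diff unfolding closed_csubspace_def complex_vector.subspace_def
  by blast+

text \<open>The parallelogram identity makes every minimising sequence for the distance to \<open>x\<close> a
  Cauchy sequence, because the midpoint of two of its members is again no closer to \<open>x\<close> than
  the infimum.\<close>

lemma nearest_point_exists:
  fixes N :: "'a::chilbert_space set"
  assumes N: "closed_csubspace N"
  obtains y where "y \<in> N" "\<And>z. z \<in> N \<Longrightarrow> norm (x - y) \<le> norm (x - z)"
proof -
  define D where "D = (INF z\<in>N. (norm (x - z))\<^sup>2)"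
  have bdd: "bdd_below ((\<lambda>z. (norm (x - z))\<^sup>2) ` N)"
    by (rule bdd_belowI[of _ 0]) auto
  have D: "D \<le> (norm (x - z))\<^sup>2" if "z \<in> N" for z
    unfolding D_def by (rule cINF_lower[OF bdd that])
  have "\<exists>y\<in>N. (norm (x - y))\<^sup>2 < D + 1 / Suc n" for n
    using cINF_less_iff[OF _ bdd, of "D + 1 / Suc n"] closed_csubspaceD(1)[OF N]
    unfolding D_def[symmetric] by fastforce
  then obtain Y where YN: "\<And>n. Y n \<in> N" and Y: "\<And>n. (norm (x - Y n))\<^sup>2 < D + 1 / Suc n"
    by metis
  have close: "(norm (Y m - Y n))\<^sup>2 < 2 / Suc m + 2 / Suc n" for m n
  proof -
    define s where "s = (1/2 :: real) *\<^sub>R (Y m + Y n)"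
    have "s \<in> N"
      unfolding s_def scaleR_scaleC by (intro closed_csubspaceD[OF N] YN)
    have "(norm (Y m - Y n))\<^sup>2 =
        2 * (norm (x - Y m))\<^sup>2 + 2 * (norm (x - Y n))\<^sup>2 - 4 * (norm (x - s))\<^sup>2"
      unfolding power2_norm_eq_inner s_def
      by (simp add: inner_diff_left inner_diff_right inner_add_left inner_add_right inner_commute
          algebra_simps)
    then show ?thesis
      using Y[of m] Y[of n] D[OF \<open>s \<in> N\<close>] by simp
  qed
  have "Cauchy Y"
  proof (rule metric_CauchyI)
    fix e :: real assume "e > 0"
    obtain M where M: "inverse (real (Suc M)) < e\<^sup>2 / 4"
      using reals_Archimedean[of "e\<^sup>2 / 4"] \<open>e > 0\<close> by auto
    have "dist (Y m) (Y n) < e" if "m \<ge> M" "n \<ge> M" for m n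
    proof -
      have "1 / Suc m \<le> 1 / Suc M" "1 / Suc n \<le> 1 / Suc M"
        using that by (auto intro!: divide_left_mono)
      then have "(norm (Y m - Y n))\<^sup>2 < e\<^sup>2"
        using close[of m n] M by (simp add: inverse_eq_divide)
      then show ?thesis
        using \<open>e > 0\<close> by (simp add: dist_norm power2_less_imp_less)
    qed
    then show "\<exists>M. \<forall>m\<ge>M. \<forall>n\<ge>M. dist (Y m) (Y n) < e" by blast
  qed
  then obtain y where y: "Y \<longlonglongrightarrow> y"
    by (auto simp: Cauchy_convergent_iff convergent_def)
  have "y \<in> N"
    using closed_csubspaceD(5)[OF N] YN y by (rule closed_sequentially)
  have "(norm (x - y))\<^sup>2 \<le> D + 0"
  proof (rule tendsto_le)
    show "(\<lambda>n. (norm (x - Y n))\<^sup>2) \<longlonglongrightarrow> (norm (x - y))\<^sup>2"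
      by (intro tendsto_intros y)
    show "(\<lambda>n. D + 1 / Suc n) \<longlonglongrightarrow> D + 0"
      by (intro tendsto_intros LIMSEQ_Suc[OF lim_1_over_n])
  qed (use Y in \<open>auto intro!: always_eventually less_imp_le\<close>)
  then have "norm (x - y) \<le> norm (x - z)" if "z \<in> N" for z
    using D[OF that] by (simp add: power2_le_imp_le)
  then show ?thesis
    using that \<open>y \<in> N\<close> by blast
qed

text \<open>A residual that is orthogonal to the complex subspace \<open>N\<close> only in the real sense is orthogonal
  in the complex sense, because \<open>N\<close> contains \<open>\<i> *\<^sub>C z\<close> along with \<open>z\<close>.\<close>

lemma projection_exists:
  fixes N :: "'a::chilbert_space set"
  assumes N: "closed_csubspace N"
  obtains y where "y \<in> N" "\<And>z. z \<in> N \<Longrightarrow> cinner z (x - y) = 0"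
proof -
  obtain y where y: "y \<in> N" and near: "\<And>z. z \<in> N \<Longrightarrow> norm (x - y) \<le> norm (x - z)"
    using nearest_point_exists[OF N] by blast
  have orth: "inner z (x - y) = 0" if "z \<in> N" for z
  proof (rule ccontr)
    define r where "r = x - y"
    \<comment> \<open>the real \<open>c\<close> that minimises \<open>norm (r - c *\<^sub>R z)\<close>\<close>
    define c where "c = inner z r / inner z z"
    assume "inner z (x - y) \<noteq> 0"
    then have nz: "inner z r \<noteq> 0" "inner z z > 0"
      by (auto simp: r_def)
    have "y + c *\<^sub>R z \<in> N"
      unfolding scaleR_scaleC by (intro closed_csubspaceD[OF N] that y)
    then have "(norm r)\<^sup>2 \<le> (norm (r - c *\<^sub>R z))\<^sup>2"
      using near unfolding r_def by (intro power_mono) (auto simp: algebra_simps)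
    also have "\<dots> = (norm r)\<^sup>2 - 2 * c * inner z r + c * (c * inner z z)"
      unfolding power2_norm_eq_inner
      by (simp add: inner_diff_left inner_diff_right inner_commute algebra_simps)
    also have "\<dots> = (norm r)\<^sup>2 - (inner z r)\<^sup>2 / inner z z"
      using nz by (simp add: c_def power2_eq_square)
    finally have "(inner z r)\<^sup>2 / inner z z \<le> 0" by simp
    then show False
      using nz by (simp add: divide_le_0_iff)
  qed
  have "cinner z (x - y) = 0" if "z \<in> N" for z
    using orth[OF that] orth[OF closed_csubspaceD(4)[OF N that, of \<i>]]
    by (simp add: cinner_conv_inner complex_eq_iff)
  then show ?thesis
    using that y by blast
qed

lemma orth_proj_eqI:
  assumes N: "closed_csubspace N"
    and y: "y \<in> N" "\<And>z. z \<in> N \<Longrightarrow> cinner z (x - y) = 0"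
  shows "orth_proj N x = y"
  unfolding orth_proj_def
proof (rule the_equality)
  fix y' assume y': "y' \<in> N \<and> (\<forall>z\<in>N. cinner z (x - y') = 0)"
  then have "y' - y \<in> N"
    using closed_csubspaceD(3)[OF N] y by blast
  then have "cinner (y' - y) ((x - y) - (x - y')) = 0"
    using y y' by (subst cinner_diff_right) auto
  then show "y' = y"
    by (simp add: cinner_self)
qed (use y in auto)

lemma orth_proj_mem_orthogonal:
  fixes N :: "'a::chilbert_space set"
  assumes "closed_csubspace N"
  shows "orth_proj N x \<in> N" "z \<in> N \<Longrightarrow> cinner z (x - orth_proj N x) = 0"
proof -
  obtain y where y: "y \<in> N" "\<And>z. z \<in> N \<Longrightarrow> cinner z (x - y) = 0"
    using projection_exists[OF assms] by blast
  then have "orth_proj N x = y"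
    by (rule orth_proj_eqI[OF assms])
  then show "orth_proj N x \<in> N" "z \<in> N \<Longrightarrow> cinner z (x - orth_proj N x) = 0"
    using y by auto
qed

lemma clinear_orth_proj:
  fixes N :: "'a::chilbert_space set"
  assumes N: "closed_csubspace N"
  shows "clinear (orth_proj N)"
  unfolding clinear_iff
proof (intro conjI allI; rule orth_proj_eqI[OF N])
  fix x y z and c :: complex
  note P = orth_proj_mem_orthogonal[OF N]
  show "orth_proj N x + orth_proj N y \<in> N" "c *\<^sub>C orth_proj N x \<in> N"
    by (intro closed_csubspaceD[OF N] P)+
  assume "z \<in> N"
  then show "cinner z (x + y - (orth_proj N x + orth_proj N y)) = 0"
    "cinner z (c *\<^sub>C x - c *\<^sub>C orth_proj N x) = 0"
    using P(2)[of z x] P(2)[of z y]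
    by (simp_all add: cinner_diff_right cinner_add_right cinner_scaleC_right)
qed

lemma norm_orth_proj_le:
  fixes N :: "'a::chilbert_space set"
  assumes N: "closed_csubspace N"
  shows "norm (orth_proj N x) \<le> norm x"
proof (rule power2_le_imp_le)
  let ?p = "orth_proj N x"
  have "inner ?p (x - ?p) = 0"
    using orth_proj_mem_orthogonal[OF N] by (simp add: inner_eq_Re_cinner)
  then have "(norm x)\<^sup>2 = (norm ?p)\<^sup>2 + (norm (x - ?p))\<^sup>2"
    using norm_add_Pythagorean[of ?p "x - ?p"] by (simp add: orthogonal_def)
  then show "(norm ?p)\<^sup>2 \<le> (norm x)\<^sup>2" by simp
qed simp

lemma closed_csubspace_range_isometry:
  fixes U :: "'a::chilbert_space \<Rightarrow> 'b::chilbert_space"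
  assumes U: "clinear U" and iso: "\<And>x. norm (U x) = norm x"
  shows "closed_csubspace (range U)"
proof -
  have "complex_vector.subspace (range U)"
    unfolding complex_vector.subspace_def
  proof (intro conjI ballI allI)
    have "0 = U 0"
      using clinear_diff[OF U, of 0 0] by simp
    then show "0 \<in> range U"
      by (rule range_eqI)
    fix a b and c :: complex
    assume "a \<in> range U"
    then obtain x where x: "a = U x" by blast
    then have "c *\<^sub>C a = U (c *\<^sub>C x)"
      using U by (simp add: clinear_iff)
    then show "c *\<^sub>C a \<in> range U"
      by (rule range_eqI)
    assume "b \<in> range U"
    then obtain y where "b = U y" by blast
    then have "a + b = U (x + y)"
      using U x by (simp add: clinear_iff)
    then show "a + b \<in> range U"
      by (rule range_eqI)
  qed
  moreover have "complete (range U)"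
  proof (rule complete_isometric_image[where e = 1])
    show "bounded_linear U"
      using clinear_imp_linear[OF U] iso
      by (intro bounded_linear_intro[where K = 1]) (simp_all add: linear_iff)
  qed (use iso in \<open>auto simp: complete_UNIV\<close>)
  ultimately show ?thesis
    by (simp add: closed_csubspace_def complete_imp_closed)
qed

lemma cadjoint_eqI:
  assumes "\<And>x y. cinner (T x) y = cinner x (G y)"
  shows "cadjoint T = G"
  unfolding cadjoint_def
proof (rule the_equality)
  fix G' assume "\<forall>x y. cinner (T x) y = cinner x (G' y)"
  then show "G' = G"
    using assms by (metis cinner_eqI ext)
qed (use assms in auto)

section \<open>Words and their commutation coefficients\<close>

definition multidegree :: "'n list \<Rightarrow> ('n \<Rightarrow>\<^sub>0 nat)" where
  "multidegree w = (\<Sum>i\<leftarrow>w. Poly_Mapping.single i 1)"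

lemma multidegree_simps [simp]:
  "multidegree [] = 0" "multidegree (i # w) = Poly_Mapping.single i 1 + multidegree w"
  by (simp_all add: multidegree_def)

lemma multidegree_append [simp]: "multidegree (v @ w) = multidegree v + multidegree w"
  by (simp add: multidegree_def)

lemma lookup_multidegree: "Poly_Mapping.lookup (multidegree w) i = count (mset w) i"
  by (induction w) (auto simp: lookup_add lookup_single when_def)

text \<open>Words with the same multidegree are the rearrangements of each other; this turns counting them
  into counting the permutations of a multiset.\<close>

lemma multidegree_eq_iff: "multidegree v = multidegree w \<longleftrightarrow> mset v = mset w"
  by (simp add: poly_mapping_eq_iff multiset_eq_iff lookup_multidegree fun_eq_iff)

lemma multidegree_surj:
  fixes k :: "'n::finite \<Rightarrow>\<^sub>0 nat"
  obtains w where "multidegree w = k"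
proof -
  obtain w where "mset w = Abs_multiset (Poly_Mapping.lookup k)"
    using ex_mset by blast
  then have "Poly_Mapping.lookup (multidegree w) i = Poly_Mapping.lookup k i" for i
    by (simp add: lookup_multidegree)
  then show ?thesis
    using that poly_mapping_eqI by blast
qed

lemma words_of_multidegree:
  "{v. multidegree v = multidegree w} = permutations_of_multiset (mset w)"
  by (auto simp: multidegree_eq_iff permutations_of_multiset_def)

lemma finite_multidegree_eq: "finite {v. multidegree v = k}"
  for k :: "'n::finite \<Rightarrow>\<^sub>0 nat"
  by (rule multidegree_surj[of k]) (auto simp: words_of_multidegree)

text \<open>The squared norm prescribed for \<open>z\<^sup>k\<close> is the reciprocal of a multinomial coefficient, which
  counts the words of multidegree \<open>k\<close>. This is why spreading \<open>z\<^sup>k\<close> evenly over these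
  words is isometric.\<close>

lemma monom_weight_card:
  fixes k :: "'n::finite \<Rightarrow>\<^sub>0 nat"
  shows "monom_weight k * card {v. multidegree v = k} = 1"
proof -
  obtain w where w: "multidegree w = k" by (rule multidegree_surj)
  have "(\<Sum>i\<in>UNIV. Poly_Mapping.lookup k i) = size (mset w)"
    unfolding size_multiset_overloaded_eq using w
    by (intro sum.mono_neutral_cong_right) (auto simp: lookup_multidegree count_eq_zero_iff)
  moreover have "(\<Prod>i\<in>UNIV. fact (Poly_Mapping.lookup k i)) =
      real (\<Prod>i\<in>set_mset (mset w). fact (count (mset w) i))"
    unfolding of_nat_prod of_nat_fact using w
    by (intro prod.mono_neutral_cong_right) (auto simp: lookup_multidegree count_mset_0_iff[THEN iffD2])
  moreover have "card {v. multidegree v = k} * (\<Prod>i\<in>set_mset (mset w). fact (count (mset w) i))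
      = fact (size (mset w))"
    unfolding w[symmetric] words_of_multidegree by (rule card_permutations_of_multiset_aux)
  then have "real (card {v. multidegree v = k}) *
      real (\<Prod>i\<in>set_mset (mset w). fact (count (mset w) i)) = fact (size (mset w))"
    by (metis of_nat_fact of_nat_mult)
  ultimately show ?thesis
    by (simp add: monom_weight_def mult.commute)
qed

text \<open>Adjacent transpositions suffice to bring any letter to the front of a word, hence to generate
  all rearrangements. The prefix \<open>u\<close> is what lets the induction act on the tail of a word.\<close>

lemma swap_invariant_imp_mset_invariant:
  assumes swap: "\<And>u i j w. g (u @ j # i # w) = g (u @ i # j # w)"
    and "mset v = mset w"
  shows "g v = g w"
proof -
  have move: "g (u @ a @ i # b) = g (u @ i # a @ b)" for u a i b
  proof (induction a arbitrary: u)
    case (Cons j a)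
    show ?case
      using Cons[of "u @ [j]"] swap[of u j i "a @ b"] by simp
  qed simp
  have "g (u @ v) = g (u @ w)" if "mset v = mset w" for u v w
    using that
  proof (induction v arbitrary: u w)
    case (Cons i v)
    then have "i \<in> set w"
      by (metis list.set_intros(1) mset_eq_setD)
    then obtain a b where w: "w = a @ i # b"
      by (meson split_list)
    have "g ((u @ [i]) @ v) = g ((u @ [i]) @ a @ b)"
      by (rule Cons.IH) (use Cons.prems w in simp)
    then show ?case
      by (simp add: w move)
  qed simp
  from this[of v w "[]"] show ?thesis
    using assms(2) by simp
qed

text \<open>The factor in \<open>z\<^sub>w\<^sub>1 \<dots> z\<^sub>w\<^sub>m = reorder q w \<cdot> z\<^bsup>multidegree w\<^esup>\<close>.\<close>

fun reorder :: "('n::{finite,linorder} \<Rightarrow> 'n \<Rightarrow> complex) \<Rightarrow> 'n list \<Rightarrow> complex" where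
  "reorder q [] = 1"
| "reorder q (i # w) = qtwist q (Poly_Mapping.single i 1) (multidegree w) * reorder q w"

lemma qtwist_unimodular: "(\<And>i j. cmod (q i j) = 1) \<Longrightarrow> cmod (qtwist q k l) = 1"
  unfolding qtwist_def prod_norm[symmetric] by (auto intro!: prod.neutral simp: norm_power)

lemma reorder_unimodular: "(\<And>i j. cmod (q i j) = 1) \<Longrightarrow> cmod (reorder q w) = 1"
  by (induction w) (simp_all add: norm_mult qtwist_unimodular)

lemma unimodular_cnj: "cmod z = 1 \<Longrightarrow> cnj z * z = 1" "cmod z = 1 \<Longrightarrow> z * cnj z = 1"
  by (simp_all add: complex_norm_square[symmetric] mult.commute)

lemma reorder_swap:
  assumes "\<And>i j. cmod (q i j) = 1" "\<And>i. q i i = 1" "\<And>i j. q j i = inverse (q i j)"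
  shows "reorder q (u @ j # i # w) = q i j * reorder q (u @ i # j # w)"
proof (induction u)
  case Nil
  have "q i j \<noteq> 0"
    using assms(1)[of i j] by auto
  then have "q i j * q j i = 1"
    using assms(3)[of j i] by simp
  then show ?case
    using assms(2)
    by (cases i j rule: linorder_cases)
      (simp_all add: qtwist_add_right qtwist_single mult.assoc mult.left_commute)
next
  case (Cons a u)
  then show ?case
    by (simp add: algebra_simps)
qed

section \<open>The \<open>q\<close>-commuting Fock space\<close>

lift_definition annihilation :: "'n \<Rightarrow> 'n fock \<Rightarrow> 'n fock" is "\<lambda>i f w. f (i # w)"
proof -
  fix i :: 'n and f :: "'n list \<Rightarrow> complex"
  assume "(\<lambda>x. (cmod (f x))\<^sup>2) summable_on UNIV"
  then have "(\<lambda>x. (cmod (f x))\<^sup>2) summable_on range ((#) i)"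
    by (rule summable_on_subset_banach) simp
  then show "(\<lambda>w. (cmod (f (i # w)))\<^sup>2) summable_on UNIV"
    by (subst (asm) summable_on_reindex) (auto simp: o_def)
qed

lemmas coord_annihilation [simp] = annihilation.rep_eq

lemma coord_left_creation:
  "coord (left_creation i x) w = (case w of [] \<Rightarrow> 0 | j # u \<Rightarrow> if j = i then coord x u else 0)"
  by (cases w) (auto simp: left_creation_def creation.rep_eq axis_def)

lemma cinner_left_creation:
  "cinner (left_creation i x) y = cinner x (annihilation i y)"
proof -
  have "cinner (left_creation i x) y =
      (\<Sum>\<^sub>\<infinity>w\<in>range ((#) i). cnj (coord (left_creation i x) w) * coord y w)"
    unfolding cinner_ell2_def
    by (rule infsum_cong_neutral) (auto simp: coord_left_creation split: list.splits)
  also have "\<dots> = (\<Sum>\<^sub>\<infinity>u. cnj (coord x u) * coord y (i # u))"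
    by (subst infsum_reindex) (auto simp: o_def coord_left_creation)
  finally show ?thesis
    by (simp add: cinner_ell2_def)
qed

lemma cadjoint_left_creation: "cadjoint (left_creation i) = annihilation i"
  by (rule cadjoint_eqI) (rule cinner_left_creation)

lemma clinear_left_creation: "clinear (left_creation i)"
  unfolding clinear_iff
  by (auto intro!: ell2_eqI simp: coord_left_creation coord_simps split: list.splits)

lemma norm_left_creation: "norm (left_creation i x) = norm x"
proof -
  have "annihilation i (left_creation i x) = x"
    by (rule ell2_eqI) (simp add: coord_left_creation)
  then have "cinner (left_creation i x) (left_creation i x) = cinner x x"
    by (simp add: cinner_left_creation)
  then show ?thesis
    by (simp add: cinner_self flip: of_real_power)
qed

lemma continuous_on_coord: "continuous_on S (\<lambda>x. coord x a)"
proof -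
  have "bounded_linear (\<lambda>x. coord x a)"
    by (rule bounded_linear_intro[where K = 1])
      (simp_all add: coord_simps scaleR_scaleC coord_le_norm scaleR_conv_of_real)
  then show ?thesis
    by (rule linear_continuous_on)
qed

text \<open>For unimodular \<open>q\<close>, the coefficient of such an \<open>h\<close> at \<open>w\<close> is the conjugate of \<open>reorder q w\<close>
  times a number that depends on the multidegree alone. Comparing any two rearrangements avoids choosing that number.\<close>

definition q_symmetric :: "('n::{finite,linorder} \<Rightarrow> 'n \<Rightarrow> complex) \<Rightarrow> 'n fock set" where
  "q_symmetric q = {h. \<forall>v w. multidegree v = multidegree w \<longrightarrow>
     reorder q v * coord h v = reorder q w * coord h w}"

lemma q_symmetricD:
  "h \<in> q_symmetric q \<Longrightarrow> multidegree v = multidegree w \<Longrightarrow>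
     reorder q v * coord h v = reorder q w * coord h w"
  unfolding q_symmetric_def by blast

lemma closed_csubspace_q_symmetric: "closed_csubspace (q_symmetric q)"
  unfolding closed_csubspace_def
proof
  show "complex_vector.subspace (q_symmetric q)"
    unfolding complex_vector.subspace_def
  proof (intro conjI ballI allI)
    fix g h :: "'a fock" and c :: complex
    assume g: "g \<in> q_symmetric q"
    have "reorder q v * (c * coord g v) = reorder q w * (c * coord g w)"
      if "multidegree v = multidegree w" for v w
      using q_symmetricD[OF g that] by (metis mult.left_commute)
    then show "c *\<^sub>C g \<in> q_symmetric q"
      unfolding q_symmetric_def mem_Collect_eq coord_simps by blast
    assume h: "h \<in> q_symmetric q"
    have "reorder q v * (coord g v + coord h v) = reorder q w * (coord g w + coord h w)"
      if "multidegree v = multidegree w" for v w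
      unfolding distrib_left q_symmetricD[OF g that] q_symmetricD[OF h that] ..
    then show "g + h \<in> q_symmetric q"
      unfolding q_symmetric_def mem_Collect_eq coord_simps by blast
  qed (simp add: q_symmetric_def coord_simps)
  have "q_symmetric q = (\<Inter>(v, w)\<in>{(v, w). multidegree v = multidegree w}.
      {h. reorder q v * coord h v = reorder q w * coord h w})"
    by (auto simp: q_symmetric_def)
  moreover have "closed \<dots>"
    by (rule closed_INT)
      (auto intro: closed_Collect_eq[OF continuous_on_mult_left[OF continuous_on_coord]
          continuous_on_mult_left[OF continuous_on_coord]])
  ultimately show "closed (q_symmetric q)" by simp
qed

lemma q_symmetric_annihilation:
  assumes q: "\<And>i j. cmod (q i j) = 1" and h: "h \<in> q_symmetric q"
  shows "annihilation i h \<in> q_symmetric q"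
  unfolding q_symmetric_def
proof (intro CollectI allI impI)
  fix v w :: "'a list" assume *: "multidegree v = multidegree w"
  have "qtwist q (Poly_Mapping.single i 1) (multidegree w) \<noteq> 0"
    using qtwist_unimodular[of q, OF q] by (metis norm_zero zero_neq_one)
  moreover have "reorder q (i # v) * coord h (i # v) = reorder q (i # w) * coord h (i # w)"
    by (rule q_symmetricD[OF h]) (simp add: *)
  ultimately show "reorder q v * coord (annihilation i h) v = reorder q w * coord (annihilation i h) w"
    by (simp add: * mult.assoc)
qed

text \<open>The relation \<open>R\<^sub>i\<^sup>* R\<^sub>j\<^sup>* h = cnj (q i j) R\<^sub>j\<^sup>* R\<^sub>i\<^sup>* h\<close> compares the coefficients of \<open>h\<close> at words
  that differ by exchanging their first two letters. Invariance under all \<open>R\<^sub>i\<^sup>*\<close> strips a prefix,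
  and so extends the comparison to an exchange of adjacent letters anywhere, which is exactly
  \<open>q\<close>-symmetry. Hence every admissible subspace lies in the space of \<open>q\<close>-symmetric vectors,
  which is admissible itself.\<close>

lemma qfock_eq_q_symmetric:
  assumes q: "\<And>i j. cmod (q i j) = 1" "\<And>i. q i i = 1" "\<And>i j. q j i = inverse (q i j)"
  shows "qfock q = q_symmetric q"
  unfolding qfock_def max_q_subspace_def cadjoint_left_creation
proof (rule Greatest_equality)
  have "annihilation i (annihilation j h) =
      cnj (q i j) *\<^sub>C annihilation j (annihilation i h)" if "h \<in> q_symmetric q" for h i j
  proof (rule ell2_eqI)
    fix w
    have "reorder q ([] @ j # i # w) * coord h (j # i # w)
        = reorder q (i # j # w) * coord h (i # j # w)"
      unfolding append_Nil by (rule q_symmetricD[OF that]) (simp only: multidegree_simps add.left_commute)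
    then have "q i j * coord h (j # i # w) = coord h (i # j # w)"
      unfolding reorder_swap[where u = "[]" and j = j and i = i and w = w, of q, OF q]
      using reorder_unimodular[of q "i # j # w", OF q(1)] by auto
    then have "(cnj (q i j) * q i j) * coord h (j # i # w) = cnj (q i j) * coord h (i # j # w)"
      by (simp add: mult.assoc)
    then show "coord (annihilation i (annihilation j h)) w =
        coord (cnj (q i j) *\<^sub>C annihilation j (annihilation i h)) w"
      by (simp add: coord_simps unimodular_cnj q(1))
  qed
  then show "closed_csubspace (q_symmetric q) \<and>
    (\<forall>i. \<forall>h\<in>q_symmetric q. annihilation i h \<in> q_symmetric q) \<and>
    (\<forall>h\<in>q_symmetric q. \<forall>i j. annihilation i (annihilation j h) =
       cnj (q i j) *\<^sub>C annihilation j (annihilation i h))"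
    using closed_csubspace_q_symmetric q_symmetric_annihilation[of q, OF q(1)] by blast
next
  fix N
  assume "closed_csubspace N \<and> (\<forall>i. \<forall>h\<in>N. annihilation i h \<in> N) \<and>
    (\<forall>h\<in>N. \<forall>i j. annihilation i (annihilation j h) =
       cnj (q i j) *\<^sub>C annihilation j (annihilation i h))"
  then have inv: "\<And>i h. h \<in> N \<Longrightarrow> annihilation i h \<in> N"
    and comm: "\<And>h i j. h \<in> N \<Longrightarrow> annihilation i (annihilation j h) =
       cnj (q i j) *\<^sub>C annihilation j (annihilation i h)"
    by blast+
  have swap: "coord h (u @ j # i # w) = cnj (q i j) * coord h (u @ i # j # w)"
    if "h \<in> N" for h u i j w
    using that
  proof (induction u arbitrary: h)
    case Nil
    then show ?case
      using arg_cong[OF comm[OF Nil, of i j], of "\<lambda>x. coord x w"] by (simp add: coord_simps)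
  next
    case (Cons a u)
    then show ?case
      using Cons.IH[OF inv[OF Cons.prems, of a]] by simp
  qed
  show "N \<subseteq> q_symmetric q"
  proof
    fix h assume h: "h \<in> N"
    have "reorder q (u @ j # i # w) * coord h (u @ j # i # w) =
        reorder q (u @ i # j # w) * coord h (u @ i # j # w)" for u i j w
    proof -
      have "reorder q (u @ j # i # w) * coord h (u @ j # i # w) =
          (q i j * cnj (q i j)) * (reorder q (u @ i # j # w) * coord h (u @ i # j # w))"
        unfolding swap[OF h, of u j i w] reorder_swap[where j = j and i = i, of q, OF q]
        by simp
      then show ?thesis
        by (simp only: unimodular_cnj q(1) mult_1)
    qed
    then show "h \<in> q_symmetric q"
      unfolding q_symmetric_def multidegree_eq_iff
      using swap_invariant_imp_mset_invariant[of "\<lambda>w. reorder q w * coord h w"] by blast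
  qed
qed

section \<open>The unitary between the polynomial and the Fock model\<close>

lemma qscale_single: "qscale c (Poly_Mapping.single k a) = Poly_Mapping.single k (c * a)"
  by (rule poly_mapping_eqI) (simp add: qscale_def Poly_Mapping.map.rep_eq lookup_single when_def)

lemma qpoly_eq_sum_qmonom:
  "f = (\<Sum>k\<in>Poly_Mapping.keys f. qscale (Poly_Mapping.lookup f k) (qmonom k))"
  using qpoly_eq_sum[of f] by (simp add: qmonom_def qscale_single)

lemma qmult_qvar_qmonom:
  "qmult q (qvar i) (qmonom k) =
     qscale (qtwist q (Poly_Mapping.single i 1) k) (qmonom (Poly_Mapping.single i 1 + k))"
  by (simp add: qvar_def qmonom_def qmult_single qscale_single)

lemma qmult_qvar_qscale_qmonom:
  "qmult q (qvar i) (qscale c (qmonom k)) = qscale c (qmult q (qvar i) (qmonom k))"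
  by (simp add: qvar_def qmonom_def qmult_single qscale_single)

locale q_commuting_model =
  fixes q :: "'n::{finite,linorder} \<Rightarrow> 'n \<Rightarrow> complex"
    and J :: "'n qpoly \<Rightarrow> 'h::chilbert_space"
  assumes unimodular: "\<And>i j. cmod (q i j) = 1"
    and diagonal: "\<And>i. q i i = 1"
    and symmetric: "\<And>i j. q j i = inverse (q i j)"
    and completion: "qpoly_completion J"
begin

lemma J_add: "J (f + g) = J f + J g"
  and J_qscale: "J (qscale c f) = c *\<^sub>C J f"
  and cinner_J: "cinner (J f) (J g) = qpoly_inner f g"
  using completion by (auto simp: qpoly_completion_def)

lemma J_sum: "J (sum f A) = (\<Sum>a\<in>A. J (f a))"
proof -
  have "J 0 = 0"
    using J_add[of 0 0] by simp
  then show ?thesis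
    by (induction A rule: infinite_finite_induct) (simp_all add: J_add)
qed

lemma J_eq_sum:
  "J f = (\<Sum>k\<in>Poly_Mapping.keys f. Poly_Mapping.lookup f k *\<^sub>C J (qmonom k))"
  using arg_cong[OF qpoly_eq_sum_qmonom[of f], of J] by (simp only: J_sum J_qscale)

text \<open>Continuous statements need to be checked on polynomials only.\<close>

lemma J_dense_induct:
  assumes "closed {x. P x}" "\<And>f. P (J f)"
  shows "P x"
proof -
  have "closure (range J) \<subseteq> {x. P x}"
    using assms by (intro closure_minimal) auto
  then show ?thesis
    using completion by (auto simp: qpoly_completion_def)
qed

lemma cinner_J_qmonom:
  "cinner (J (qmonom k)) (J f) = complex_of_real (monom_weight k) * Poly_Mapping.lookup f k"
proof (cases "k \<in> Poly_Mapping.keys f")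
  case True
  then show ?thesis
    by (simp add: cinner_J qpoly_inner_def qmonom_def)
next
  case False
  then show ?thesis
    by (simp add: cinner_J qpoly_inner_def qmonom_def in_keys_iff)
qed

lemma norm_J_square:
  "(norm (J f))\<^sup>2 =
     (\<Sum>k\<in>Poly_Mapping.keys f. monom_weight k * (cmod (Poly_Mapping.lookup f k))\<^sup>2)"
proof -
  have "cnj z * z = complex_of_real ((cmod z)\<^sup>2)" for z
    by (metis complex_norm_square mult.commute)
  then have "complex_of_real ((norm (J f))\<^sup>2) = complex_of_real
      (\<Sum>k\<in>Poly_Mapping.keys f. monom_weight k * (cmod (Poly_Mapping.lookup f k))\<^sup>2)"
    unfolding cinner_self[symmetric] by (simp add: cinner_J qpoly_inner_def)
  then show ?thesis
    by (simp only: of_real_eq_iff)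
qed

text \<open>On \<open>z\<^sup>k\<close> this gives \<open>cnj (reorder q w) * monom_weight k\<close> at every word \<open>w\<close> of
  multidegree \<open>k\<close>, and zero elsewhere. Writing the coefficients as inner products defines the map
  on the whole completion at once, so that no extension from polynomials is needed.\<close>

definition fock_coeff :: "'h \<Rightarrow> 'n list \<Rightarrow> complex" where
  "fock_coeff x w = cnj (reorder q w) * cinner (J (qmonom (multidegree w))) x"

definition to_fock :: "'h \<Rightarrow> 'n fock" where
  "to_fock x = Abs_ell2 (fock_coeff x)"

lemma norm_fock_coeff: "cmod (fock_coeff x w) = cmod (cinner (J (qmonom (multidegree w))) x)"
  by (simp add: fock_coeff_def norm_mult reorder_unimodular unimodular)

lemma finite_words: "finite {w :: 'n list. multidegree w \<in> Poly_Mapping.keys f}"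
proof -
  have "finite (\<Union>k\<in>Poly_Mapping.keys f. {w :: 'n list. multidegree w = k})"
    by (intro finite_UN_I finite_keys finite_multidegree_eq)
  then show ?thesis
    by (rule finite_subset[rotated]) auto
qed

text \<open>For each \<open>k\<close> the number of words of multidegree \<open>k\<close> cancels one of the two factors
  \<open>monom_weight k\<close>.\<close>

lemma sum_fock_coeff_J:
  "(\<Sum>w | multidegree w \<in> Poly_Mapping.keys f. (cmod (fock_coeff (J f) w))\<^sup>2) = (norm (J f))\<^sup>2"
proof -
  have *: "{w :: 'n list. multidegree w \<in> Poly_Mapping.keys f} =
      (\<Union>k\<in>Poly_Mapping.keys f. {w. multidegree w = k})"
    by auto
  have "(\<Sum>w | multidegree w \<in> Poly_Mapping.keys f. (cmod (fock_coeff (J f) w))\<^sup>2) =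
      (\<Sum>k\<in>Poly_Mapping.keys f. \<Sum>w | multidegree w = k. (cmod (fock_coeff (J f) w))\<^sup>2)"
    unfolding * by (rule sum.UNION_disjoint) (auto intro: finite_multidegree_eq)
  also have "\<dots> = (\<Sum>k\<in>Poly_Mapping.keys f. monom_weight k * (cmod (Poly_Mapping.lookup f k))\<^sup>2)"
  proof (rule sum.cong)
    fix k
    have "(\<Sum>w | multidegree w = k. (cmod (fock_coeff (J f) w))\<^sup>2) =
        (monom_weight k * card {w :: 'n list. multidegree w = k}) *
        (monom_weight k * (cmod (Poly_Mapping.lookup f k))\<^sup>2)"
      using monom_weight_pos[of k]
      by (simp add: norm_fock_coeff cinner_J_qmonom norm_mult power2_eq_square)
    then show "(\<Sum>w | multidegree w = k. (cmod (fock_coeff (J f) w))\<^sup>2) =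
        monom_weight k * (cmod (Poly_Mapping.lookup f k))\<^sup>2"
      by (simp add: monom_weight_card)
  qed simp
  finally show ?thesis
    by (simp add: norm_J_square)
qed

text \<open>A Bessel inequality for each finite set of words, proved by density; it yields square
  summability of the coefficients of an arbitrary vector.\<close>

lemma fock_coeff_bessel:
  assumes "finite F"
  shows "(\<Sum>w\<in>F. (cmod (fock_coeff x w))\<^sup>2) \<le> (norm x)\<^sup>2"
proof (induction x rule: J_dense_induct)
  case 1
  show ?case
    unfolding norm_fock_coeff by (intro closed_Collect_le continuous_intros)
next
  case (2 f)
  let ?W = "{w :: 'n list. multidegree w \<in> Poly_Mapping.keys f}"
  have zero: "fock_coeff (J f) w = 0" if "w \<notin> ?W" for w
    using that by (simp add: fock_coeff_def cinner_J_qmonom in_keys_iff)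
  have "(\<Sum>w\<in>F. (cmod (fock_coeff (J f) w))\<^sup>2) =
      (\<Sum>w\<in>F \<inter> ?W. (cmod (fock_coeff (J f) w))\<^sup>2)"
    using assms by (intro sum.mono_neutral_right) (auto simp: zero)
  also have "\<dots> \<le> (\<Sum>w\<in>?W. (cmod (fock_coeff (J f) w))\<^sup>2)"
    by (rule sum_mono2[OF finite_words]) auto
  finally show ?case
    by (simp add: sum_fock_coeff_J)
qed

lemma coord_to_fock: "coord (to_fock x) = fock_coeff x"
proof -
  have "(\<lambda>w. (cmod (fock_coeff x w))\<^sup>2) summable_on UNIV"
    by (rule nonneg_bdd_above_summable_on)
      (auto intro!: bdd_aboveI[of _ "(norm x)\<^sup>2"] fock_coeff_bessel)
  then show ?thesis
    by (simp add: to_fock_def Abs_ell2_inverse)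
qed

lemma clinear_to_fock: "clinear to_fock"
  unfolding clinear_iff
  by (auto intro!: ell2_eqI simp: coord_to_fock coord_simps fock_coeff_def cinner_add_right
      cinner_scaleC_right distrib_left)

lemma norm_to_fock_le: "norm (to_fock x) \<le> norm x"
proof (rule power2_le_imp_le)
  have "(\<lambda>w. (cmod (fock_coeff x w))\<^sup>2) summable_on UNIV"
    using summable_coord[of "to_fock x"] by (simp add: coord_to_fock)
  then show "(norm (to_fock x))\<^sup>2 \<le> (norm x)\<^sup>2"
    unfolding norm_ell2_square coord_to_fock
    by (rule infsum_le_finite_sums) (rule fock_coeff_bessel)
qed simp

lemma norm_to_fock: "norm (to_fock x) = norm x"
proof (induction x rule: J_dense_induct)
  case 1
  have "bounded_clinear to_fock"
    unfolding bounded_clinear_def using clinear_to_fock norm_to_fock_le by (metis mult_1)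
  then show ?case
    by (intro closed_Collect_eq continuous_intros bounded_clinear_continuous_on)
next
  case (2 f)
  have "(norm (J f))\<^sup>2 \<le> (norm (to_fock (J f)))\<^sup>2"
    using sum_coord_le_norm[OF finite_words[of f], of "to_fock (J f)"]
    by (simp add: coord_to_fock sum_fock_coeff_J)
  then have "norm (J f) \<le> norm (to_fock (J f))"
    by (rule power2_le_imp_le) simp
  then show ?case
    by (intro antisym norm_to_fock_le)
qed

lemma to_fock_mem: "to_fock x \<in> q_symmetric q"
proof -
  have "reorder q w * coord (to_fock x) w = cinner (J (qmonom (multidegree w))) x" for w
    using unimodular_cnj(2)[OF reorder_unimodular, of q w] unimodular
    by (simp add: coord_to_fock fock_coeff_def mult.assoc[symmetric])
  then show ?thesis
    by (simp add: q_symmetric_def)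
qed

text \<open>All terms of the inner product agree when \<open>y\<close> is \<open>q\<close>-symmetric, and their number is
  the reciprocal of their common weight. So pairing with the image of \<open>z\<^sup>k\<close> reads off the one
  number that determines \<open>y\<close> on the words of multidegree \<open>k\<close>.\<close>

lemma cinner_to_fock_qmonom:
  assumes y: "y \<in> q_symmetric q"
  shows "cinner (to_fock (J (qmonom (multidegree v)))) y = reorder q v * coord y v"
proof -
  let ?k = "multidegree v" and ?x = "to_fock (J (qmonom (multidegree v)))"
  have coeff: "cnj (coord ?x w) * coord y w =
      (if multidegree w = ?k then complex_of_real (monom_weight ?k) * (reorder q v * coord y v) else 0)"
    for w
  proof (cases "multidegree w = ?k")
    case True
    have "cnj (coord ?x w) * coord y w =
        complex_of_real (monom_weight ?k) * (reorder q w * coord y w)"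
      using True by (simp add: coord_to_fock fock_coeff_def cinner_J_qmonom) (simp add: qmonom_def)
    then show ?thesis
      by (simp only: True simp_thms if_True q_symmetricD[OF y True])
  next
    case False
    then show ?thesis
      by (simp add: coord_to_fock fock_coeff_def cinner_J_qmonom)
        (simp add: qmonom_def lookup_single)
  qed
  have "cinner ?x y = (\<Sum>\<^sub>\<infinity>w\<in>{w. multidegree w = ?k}.
      complex_of_real (monom_weight ?k) * (reorder q v * coord y v))"
    unfolding cinner_ell2_def coeff by (rule infsum_cong_neutral) auto
  also have "\<dots> = complex_of_real (monom_weight ?k * card {w. multidegree w = ?k}) *
      (reorder q v * coord y v)"
    by (simp add: infsum_finite finite_multidegree_eq)
  finally show ?thesis
    by (simp add: monom_weight_card)
qed

text \<open>An isometry has a closed range, and a \<open>q\<close>-symmetric vector orthogonal to the images of all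
  monomials has no nonzero coefficient.\<close>

lemma range_to_fock: "range to_fock = q_symmetric q"
proof
  show "range to_fock \<subseteq> q_symmetric q"
    using to_fock_mem by auto
  have closed: "closed_csubspace (range to_fock)"
    by (rule closed_csubspace_range_isometry[OF clinear_to_fock norm_to_fock])
  show "q_symmetric q \<subseteq> range to_fock"
  proof
    fix h assume h: "h \<in> q_symmetric q"
    obtain p where p: "p \<in> range to_fock" "\<And>z. z \<in> range to_fock \<Longrightarrow> cinner z (h - p) = 0"
      using projection_exists[OF closed] by blast
    then have "p \<in> q_symmetric q"
      using to_fock_mem by blast
    then have "h - p \<in> q_symmetric q"
      using closed_csubspaceD(3)[OF closed_csubspace_q_symmetric] h by blast
    then have "reorder q v * coord (h - p) v = 0" for v
      using p(2) cinner_to_fock_qmonom by (metis rangeI)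
    then have "coord (h - p) v = 0" for v
      using reorder_unimodular[of q v] unimodular by (metis mult_eq_0_iff norm_zero zero_neq_one)
    then have "h = p"
      by (intro ell2_eqI) (simp add: coord_simps)
    then show "h \<in> range to_fock"
      using p(1) by simp
  qed
qed

lemma inj_to_fock: "to_fock x = to_fock y \<Longrightarrow> x = y"
  using norm_to_fock[of "x - y"] by (simp add: clinear_diff[OF clinear_to_fock])

text \<open>This is \<open>S\<^sub>i U\<close>, where \<open>S\<^sub>i\<close> is the compression of the \<open>i\<close>-th creation operator.\<close>

definition compressed_creation :: "'n \<Rightarrow> 'h \<Rightarrow> 'n fock" where
  "compressed_creation i x = orth_proj (q_symmetric q) (left_creation i (to_fock x))"

lemma clinear_compressed_creation: "clinear (compressed_creation i)"
  using clinear_orth_proj[OF closed_csubspace_q_symmetric[of q]] clinear_left_creation[of i]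
    clinear_to_fock
  unfolding clinear_iff compressed_creation_def by simp

lemma norm_compressed_creation_le: "norm (compressed_creation i x) \<le> norm x"
  using norm_orth_proj_le[OF closed_csubspace_q_symmetric, of q "left_creation i (to_fock x)"]
  by (simp add: compressed_creation_def norm_left_creation norm_to_fock)

text \<open>By \<open>orth_proj_eqI\<close> it is enough to pair both sides with a \<open>q\<close>-symmetric \<open>y\<close>. On the
  Fock side the adjoint of creation reads the coefficient of \<open>y\<close> at \<open>i # v\<close>; on the polynomial
  side the factor from moving \<open>z\<^sub>i\<close> into place cancels against the factor by which
  \<open>reorder q (i # v)\<close> differs from \<open>reorder q v\<close>.\<close>

lemma compressed_creation_qmonom:
  "compressed_creation i (J (qmonom k)) = to_fock (J (qmult q (qvar i) (qmonom k)))"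
  unfolding compressed_creation_def
proof (rule orth_proj_eqI[OF closed_csubspace_q_symmetric to_fock_mem])
  fix y assume y: "y \<in> q_symmetric q"
  obtain v where v: "multidegree v = k" by (rule multidegree_surj)
  let ?t = "qtwist q (Poly_Mapping.single i 1) k"
  have "cinner (to_fock (J (qmult q (qvar i) (qmonom k)))) y =
      cnj ?t * cinner (to_fock (J (qmonom (multidegree (i # v))))) y"
    using clinear_to_fock
    by (simp add: qmult_qvar_qmonom J_qscale clinear_iff cinner_scaleC_left v)
  also have "\<dots> = (cnj ?t * ?t) * (reorder q v * coord (annihilation i y) v)"
    unfolding cinner_to_fock_qmonom[OF y] by (simp add: v)
  also have "\<dots> = reorder q v * coord (annihilation i y) v"
    by (simp only: unimodular_cnj(1)[OF qtwist_unimodular[of q, OF unimodular]] mult_1)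
  also have "\<dots> = cinner (to_fock (J (qmonom k))) (annihilation i y)"
    using cinner_to_fock_qmonom[OF q_symmetric_annihilation[of q, OF unimodular y], of v] v by simp
  also have "\<dots> = cinner (left_creation i (to_fock (J (qmonom k)))) y"
    by (simp add: cinner_left_creation)
  finally show "cinner y (left_creation i (to_fock (J (qmonom k))) -
      to_fock (J (qmult q (qvar i) (qmonom k)))) = 0"
    by (simp only: cinner_diff_right cinner_commute[of y] diff_self)
qed

lemma compressed_creation_J:
  "compressed_creation i (J f) = to_fock (J (qmult q (qvar i) f))"
proof -
  let ?c = "Poly_Mapping.lookup f"
  have "compressed_creation i (J f) =
      (\<Sum>k\<in>Poly_Mapping.keys f. ?c k *\<^sub>C to_fock (J (qmult q (qvar i) (qmonom k))))"
    using clinear_compressed_creation[of i]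
    by (subst J_eq_sum) (simp add: clinear_sum clinear_iff compressed_creation_qmonom)
  also have "\<dots> = to_fock (J (\<Sum>k\<in>Poly_Mapping.keys f.
      qmult q (qvar i) (qscale (?c k) (qmonom k))))"
    using clinear_to_fock
    by (simp add: qmult_qvar_qscale_qmonom J_sum J_qscale clinear_sum clinear_iff)
  also have "\<dots> = to_fock (J (qmult q (qvar i) f))"
    unfolding qmult_sum_right[symmetric] using qpoly_eq_sum_qmonom[of f] by metis
  finally show ?thesis .
qed

lemma qmult_op_eqI:
  assumes T: "bounded_clinear T" "\<And>f. T (J f) = J (qmult q (qvar i) f)"
  shows "qmult_op q J i = T"
  unfolding qmult_op_def
proof (rule the_equality)
  fix T' assume T': "bounded_clinear T' \<and> (\<forall>f. T' (J f) = J (qmult q (qvar i) f))"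
  have "T' x = T x" for x
  proof (induction x rule: J_dense_induct)
    case 1
    show ?case
      using T T' by (intro closed_Collect_eq bounded_clinear_continuous_on) auto
  next
    case (2 f)
    show ?case
      using T T' by simp
  qed
  then show "T' = T" by (rule ext)
qed (use T in blast)

text \<open>Pulling the compressed creation operator back along the isometry gives a bounded operator that
  multiplies polynomials by \<open>z\<^sub>i\<close>. This proves that the multiplication operator exists as a
  bounded operator, which cannot be read off from its definite description.\<close>

lemma to_fock_qmult_op: "to_fock (qmult_op q J i x) = compressed_creation i x"
proof -
  have "\<exists>y. to_fock y = compressed_creation i x" for x
    using orth_proj_mem_orthogonal(1)[OF closed_csubspace_q_symmetric, of q] range_to_fock
    unfolding compressed_creation_def by (metis rangeE)
  then obtain T where T: "\<And>x. to_fock (T x) = compressed_creation i x"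
    by metis
  have "clinear T"
    using clinear_to_fock clinear_compressed_creation[of i] unfolding clinear_iff
    by (auto intro!: inj_to_fock simp: T)
  moreover have "norm (T x) \<le> 1 * norm x" for x
    using norm_compressed_creation_le[of i x] by (simp flip: norm_to_fock T)
  ultimately have "bounded_clinear T"
    unfolding bounded_clinear_def by blast
  moreover have "T (J f) = J (qmult q (qvar i) f)" for f
    by (rule inj_to_fock) (simp add: T compressed_creation_J)
  ultimately have "qmult_op q J i = T"
    by (rule qmult_op_eqI)
  then show ?thesis
    by (simp add: T)
qed

end

theorem proposition12:
  fixes q :: "'n::{finite,linorder} \<Rightarrow> 'n \<Rightarrow> complex"
    and J :: "'n qpoly \<Rightarrow> 'h::chilbert_space"
  assumes "CARD('n) \<ge> 2"
    and "\<And>i j. cmod (q i j) = 1"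
    and "\<And>i. q i i = 1"
    and "\<And>i j. q j i = inverse (q i j)"
    and "qpoly_completion J"
  shows "\<exists>U :: 'h \<Rightarrow> 'n fock. unitary_onto U (qfock q) \<and>
           (\<forall>i x. U (qmult_op q J i x) = qshift q i (U x))"
proof -
  interpret q_commuting_model q J
    by unfold_locales (fact assms)+
  have qfock: "qfock q = q_symmetric q"
    by (rule qfock_eq_q_symmetric) (fact assms)+
  show ?thesis
  proof (intro exI conjI allI)
    show "unitary_onto to_fock (qfock q)"
      unfolding unitary_onto_def qfock
      using clinear_to_fock range_to_fock clinear_isometry_cinner[OF clinear_to_fock norm_to_fock]
      by blast
    show "to_fock (qmult_op q J i x) = qshift q i (to_fock x)" for i x
      by (simp add: to_fock_qmult_op compressed_creation_def qshift_def qfock)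
  qed
qed

end
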